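(* Let $M\ge3$ and let $p_1,\dots,p_M\ge2$ be pairwise coprime integers, $P=\prod_jp_j$. The Casson invariant $\lambda_C(\mathcal M)$ of the Seifert homology sphere $\mathcal M=\Sigma(p_1,\dots,p_M)$ is related to the coefficient $c_{M-2}(\mathcal P)$ of the Ehrhart polynomial of the $M$-dimensional tetrahedron $\mathcal P$ with vertices $(p_1,0,\dots,0),(0,p_2,0,\dots,0),\dots,(0,\dots,0,p_M)$ and $(0,\dots,0)$ by $$\lambda_C(\mathcal M)-\frac{(M-2)!}{2}\,c_{M-2}(\mathcal P)=-\frac{M+1}{8}-\frac{M-2}{24}\,P-\frac P8\sum_{1\le j<k\le M}\frac{1}{p_jp_k}.$$
   Context: The Ehrhart polynomial is $E_{\overline{\mathcal P}}(t)=\#\{(m_1,\dots,m_M)\in\mathbb Z^M : \sum_jm_j/p_j\le t,\ m_k\ge0\}=c_M(\mathcal P)t^M+c_{M-1}(\mathcal P)t^{M-1}+\cdots+c_0(\mathcal P)$ for positive integers $t$ (lattice points in the $t$-fold dilate of the closed tetrahedron). The Casson invariant of $\Sigma(p_1,\dots,p_M)$ is given by $$\lambda_C(\mathcal M)=-\frac18+\frac1{24P}\left(1+\sum_{k=1}^M\left(\frac P{p_k}\right)^2-(M-2)P^2\right)-\frac12\sum_{k=1}^Ms\!\left(\frac P{p_k},p_k\right),$$ with the Dedekind sum $s(b,a)=\sum_{k=1}^{a-1}((k/a))((kb/a))$, $((x))=x-\lfloor x\rfloor-\frac12$ for $x\notin\mathbb Z$, $((x))=0$ for $x\in\mathbb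 Z$. Known formula of Beck and Chen for the coefficient: $$(M-2)!\,c_{M-2}(\mathcal P)=\frac M4+\frac1{24P}\left(2-\sum_{k=1}^M\left(\frac P{p_k}\right)^2+3\left(\sum_{k=1}^M\frac P{p_k}\right)^2\right)-\sum_{k=1}^Ms\!\left(\frac P{p_k},p_k\right).$$ *)

theory Defs
  imports "HOL-Analysis.Analysis" "HOL-Computational_Algebra.Polynomial"
begin

definition lattice_count :: "(real ^ 'n) set \<Rightarrow> nat \<Rightarrow> nat" where
  "lattice_count S t = card {x \<in> (\<lambda>y. real t *\<^sub>R y) ` S. \<forall>i. x $ i \<in> \<int>}"

text \<open>Only positive dilation factors are used. A polynomial is determined by its values there,
  and for an integral polytope (the only intended use) one exists by Ehrhart's theorem.\<close>

definition ehrhart_poly :: "(real ^ 'n) set \<Rightarrow> real poly" where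
  "ehrhart_poly S = (THE E. \<forall>t>0. poly E (real t) = real (lattice_count S t))"

definition tetrahedron :: "('n \<Rightarrow> nat) \<Rightarrow> (real ^ 'n) set" where
  "tetrahedron p = convex hull (insert 0 (range (\<lambda>i. axis i (real (p i)))))"

definition sawtooth :: "real \<Rightarrow> real" where
  "sawtooth x = (if x \<in> \<int> then 0 else x - of_int \<lfloor>x\<rfloor> - 1/2)"

definition dedekind_sum :: "nat \<Rightarrow> nat \<Rightarrow> real" where
  "dedekind_sum b a =
     (\<Sum>k=1..a-1. sawtooth (real k / real a) * sawtooth (real k * real b / real a))"

text \<open>The Casson invariant of the Seifert homology sphere \<open>\<Sigma>(p\<^sub>1,\<dots>,p\<^sub>M)\<close>, given by its closed
  formula in terms of the pairwise coprime multiplicities \<open>p\<^sub>k\<close>; the manifold itself is not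
  constructed. The division \<open>P div p k\<close> is exact.\<close>

definition casson_seifert :: "('n::finite \<Rightarrow> nat) \<Rightarrow> real" where
  "casson_seifert p =
     (let M = real CARD('n); P = (\<Prod>k\<in>UNIV. p k) in
       - 1/8
       + 1 / (24 * real P)
         * (1 + (\<Sum>k\<in>UNIV. (real P / real (p k))^2) - (M - 2) * (real P)^2)
       - 1/2 * (\<Sum>k\<in>UNIV. dedekind_sum (P div p k) (p k)))"

text \<open>The lattice points of the dilated tetrahedron are the integer points
  \<open>m\<close> with \<open>m\<^sub>k \<ge> 0\<close> and \<open>\<Sum>\<^sub>j m\<^sub>j / p\<^sub>j \<le> t\<close>.\<close>

lemma tetrahedron_eq:
  fixes p :: "'n::finite \<Rightarrow> nat"
  assumes pos: "\<And>i. p i > 0"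
  shows "tetrahedron p = {x. (\<forall>i. 0 \<le> x $ i) \<and> (\<Sum>i\<in>UNIV. x $ i / real (p i)) \<le> 1}"
    (is "_ = ?S")
proof
  have nz: "p i \<noteq> 0" for i using pos[of i] by simp
  have "convex ?S"
  proof (rule convexI)
    fix x y :: "real ^ 'n" and u v :: real
    assume x: "x \<in> ?S" and y: "y \<in> ?S" and uv: "0 \<le> u" "0 \<le> v" "u + v = 1"
    have "(\<Sum>i\<in>UNIV. (u *\<^sub>R x + v *\<^sub>R y) $ i / real (p i))
        = u * (\<Sum>i\<in>UNIV. x $ i / real (p i)) + v * (\<Sum>i\<in>UNIV. y $ i / real (p i))"
      by (simp add: sum_distrib_left sum.distrib add_divide_distrib)
    also have "\<dots> \<le> 1"
      using convex_bound_le[of _ 1 _ u v] x y uv by simp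
    finally show "u *\<^sub>R x + v *\<^sub>R y \<in> ?S" using x y uv by simp
  qed
  moreover have "insert 0 (range (\<lambda>i. axis i (real (p i)))) \<subseteq> ?S"
  proof -
    have "(\<Sum>j\<in>UNIV. axis i (real (p i)) $ j / real (p j)) = 1" for i
    proof -
      have "(\<Sum>j\<in>UNIV. axis i (real (p i)) $ j / real (p j)) = (\<Sum>j\<in>UNIV. if j = i then 1 else 0)"
        by (intro sum.cong) (auto simp: nz axis_def)
      then show ?thesis by simp
    qed
    then show ?thesis by (auto simp: axis_def)
  qed
  ultimately show "tetrahedron p \<subseteq> ?S"
    unfolding tetrahedron_def by (rule hull_minimal[rotated])
next
  have nz: "p i \<noteq> 0" for i using pos[of i] by simp
  show "?S \<subseteq> tetrahedron p"
  proof
    fix x assume x: "x \<in> ?S"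
    let ?V = "insert 0 (range (\<lambda>i. axis i (real (p i))))"
    define c where "c i = x $ i / real (p i)" for i
    have c: "\<And>i. c i \<ge> 0" "(\<Sum>i\<in>UNIV. c i) \<le> 1" using x by (auto simp: c_def)
    have V: "convex (convex hull ?V)" by simp
    have "(\<Sum>z\<in>UNIV. case_option (1 - (\<Sum>i\<in>UNIV. c i)) c z
             *\<^sub>R case_option 0 (\<lambda>i. axis i (real (p i))) z) \<in> convex hull ?V"
      using c by (intro convex_sum V)
        (auto simp: UNIV_option_conv sum.reindex inj_on_def hull_inc split: option.split)
    moreover have "(\<Sum>z\<in>UNIV. case_option (1 - (\<Sum>i\<in>UNIV. c i)) c z
             *\<^sub>R case_option 0 (\<lambda>i. axis i (real (p i))) z) = x"
    proof -
      have "(\<Sum>i\<in>UNIV. c i *\<^sub>R axis i (real (p i))) $ j = x $ j" for j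
      proof -
        have "(\<Sum>i\<in>UNIV. c i *\<^sub>R axis i (real (p i))) $ j = (\<Sum>i\<in>UNIV. if i = j then x $ j else 0)"
          unfolding sum_component by (intro sum.cong) (auto simp: nz c_def axis_def)
        then show ?thesis by simp
      qed
      then show ?thesis
        by (simp add: UNIV_option_conv sum.reindex vec_eq_iff)
    qed
    ultimately show "x \<in> tetrahedron p" unfolding tetrahedron_def by simp
  qed
qed

lemma lattice_count_tetrahedron:
  fixes p :: "'n::finite \<Rightarrow> nat"
  assumes pos: "\<And>i. p i > 0" and t: "t > 0"
  shows "lattice_count (tetrahedron p) t =
    card {m :: int ^ 'n. (\<forall>k. m $ k \<ge> 0) \<and> (\<Sum>j\<in>UNIV. of_int (m $ j) / real (p j)) \<le> real t}"
    (is "_ = card ?B")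
proof -
  let ?A = "{x \<in> (\<lambda>y. real t *\<^sub>R y) ` tetrahedron p. \<forall>i. x $ i \<in> \<int>}"
  have dil: "(\<lambda>y. real t *\<^sub>R y) ` tetrahedron p
      = {x. (\<forall>i. 0 \<le> x $ i) \<and> (\<Sum>i\<in>UNIV. x $ i / real (p i)) \<le> real t}" (is "_ = ?T")
  proof (intro equalityI subsetI)
    fix x assume "x \<in> (\<lambda>y. real t *\<^sub>R y) ` tetrahedron p"
    then show "x \<in> ?T"
      using t by (auto simp: tetrahedron_eq[OF pos] simp flip: sum_distrib_left times_divide_eq_right)
  next
    fix x assume x: "x \<in> ?T"
    have "(\<Sum>i\<in>UNIV. ((1 / real t) *\<^sub>R x) $ i / real (p i))
        = (\<Sum>i\<in>UNIV. x $ i / real (p i)) / real t"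
      by (simp add: sum_divide_distrib mult.commute)
    with x t have "(1 / real t) *\<^sub>R x \<in> tetrahedron p"
      by (simp add: tetrahedron_eq[OF pos])
    moreover have "x = real t *\<^sub>R ((1 / real t) *\<^sub>R x)" using t by simp
    ultimately show "x \<in> (\<lambda>y. real t *\<^sub>R y) ` tetrahedron p" by blast
  qed
  have "bij_betw (\<lambda>m. \<chi> i. of_int (m $ i)) ?B ?A"
  proof (rule bij_betw_imageI)
    show "inj_on (\<lambda>m. (\<chi> i. of_int (m $ i)) :: real ^ 'n) ?B"
      by (auto simp: inj_on_def vec_eq_iff)
    show "(\<lambda>m. \<chi> i. of_int (m $ i)) ` ?B = ?A"
    proof (intro equalityI subsetI)
      fix x assume x: "x \<in> ?A"
      then have fl: "of_int \<lfloor>x $ i\<rfloor> = x $ i" for i by (auto elim: Ints_cases)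
      have "x = (\<chi> i. of_int ((\<chi> i. \<lfloor>x $ i\<rfloor>) $ i))" by (simp add: fl vec_eq_iff)
      moreover have "(\<chi> i. \<lfloor>x $ i\<rfloor>) \<in> ?B" using x by (simp add: dil fl)
      ultimately show "x \<in> (\<lambda>m. \<chi> i. of_int (m $ i)) ` ?B" by blast
    qed (auto simp: dil)
  qed
  then show ?thesis by (simp add: lattice_count_def bij_betw_same_card)
qed

end

theory Submission
  imports Defs "HOL-Number_Theory.Cong"
begin

text \<open>
  Substituting the closed formula for the Casson invariant, the theorem becomes the formula of Beck
  and Chen for \<open>(M - 2)! c\<^sub>M\<^sub>-\<^sub>2\<close>: the Dedekind sums cancel, and the remaining square
  \<open>(\<Sum>\<^sub>k P / p\<^sub>k)\<^sup>2\<close> is expanded into its diagonal and its off-diagonal part. The work is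
  the Beck--Chen formula (\<open>beck_chen\<close>), which is derived here by elementary counting.

  Divide each coordinate of a lattice point by \<open>p\<^sub>j\<close>, with remainder \<open>m\<^sub>j\<close> and quotient
  \<open>q\<^sub>j\<close>. The inequality \<open>\<Sum>\<^sub>j (m\<^sub>j + p\<^sub>j q\<^sub>j) / p\<^sub>j \<le> t\<close> says
  \<open>\<Sum>\<^sub>j q\<^sub>j \<le> t - c(m)\<close> with \<open>c(m) = \<lceil>\<Sum>\<^sub>j m\<^sub>j / p\<^sub>j\<rceil>\<close>, and the number of such
  \<open>q\<close> is a binomial coefficient \<open>(t - c(m) + M) choose M\<close>. So the Ehrhart polynomial is a sum
  of shifted binomial polynomials over the box of remainders (\<open>ehrhart_poly_tetrahedron\<close>). The
  roots of the binomial polynomial are \<open>M\<close> consecutive integers; measured from their centre,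
  their second elementary symmetric function turns the coefficient into
  \<open>\<Sum>\<^sub>m (d(m)\<^sup>2 / 2 - (M + 1) / 24)\<close>, where \<open>d(m) = c(m) - (M + 1) / 2\<close>.

  Rounding up is adding a fractional part, which gives
  \<open>d(m) = \<Sum>\<^sub>j (m\<^sub>j / p\<^sub>j - 1/2) + B(m)\<close>, where \<open>B(m)\<close> is the first periodic Bernoulli function
  at \<open>- \<Sum>\<^sub>j m\<^sub>j / p\<^sub>j\<close>. It remains to compute the second moments of these summands over the
  box. Products of coordinates factor. For the others, \<open>\<Sum>\<^sub>j m\<^sub>j / p\<^sub>j = N / P\<close> for an integer
  \<open>N\<close> that runs over every residue class modulo \<open>P\<close> exactly once, by the Chinese remainder
  theorem (\<open>bij_betw_weight_mod\<close>); this settles \<open>B\<^sup>2\<close>. Summing \<open>B\<close> over all \<open>m\<close> with \<open>m\<^sub>j\<close> fixed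
  leaves, by the multiplication formula for the Bernoulli function (\<open>sum_bern_progression\<close>), its
  value at \<open>- m\<^sub>j (P / p\<^sub>j) / p\<^sub>j\<close>, so the mixed moment with the \<open>j\<close>-th coordinate is a Dedekind
  sum (\<open>bern_cross_moment\<close>, \<open>sum_centered_bern\<close>).
\<close>

section \<open>Sums over a box\<close>

definition residue_box :: "('n \<Rightarrow> nat) \<Rightarrow> ('n \<Rightarrow> nat) set" where
  "residue_box p = (\<Pi>\<^sub>E j\<in>UNIV. {..<p j})"

text \<open>This is \<open>P / p\<^sub>j\<close>, written as a product so that no exactness of a division has to be carried
  along.\<close>

definition cofactor :: "('n::finite \<Rightarrow> nat) \<Rightarrow> 'n \<Rightarrow> nat" where
  "cofactor p j = (\<Prod>i\<in>UNIV - {j}. p i)"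

lemma in_residue_box_iff: "m \<in> residue_box p \<longleftrightarrow> (\<forall>j. m j < p j)"
  by (auto simp: residue_box_def PiE_def)

lemma finite_residue_box [simp]: "finite (residue_box (p :: 'n::finite \<Rightarrow> nat))"
  by (simp add: residue_box_def finite_PiE)

lemma card_residue_box: "card (residue_box p) = (\<Prod>j\<in>UNIV. p j)" for p :: "'n::finite \<Rightarrow> nat"
  by (simp add: residue_box_def card_PiE)

lemma prod_eq_mult_cofactor: "(\<Prod>i\<in>UNIV. p i) = p j * cofactor p j"
  by (simp add: cofactor_def prod.remove[of UNIV j])

lemma sum_box_prod:
  fixes f :: "'n::finite \<Rightarrow> nat \<Rightarrow> real"
  shows "(\<Sum>m\<in>residue_box p. \<Prod>j\<in>UNIV. f j (m j)) = (\<Prod>j\<in>UNIV. \<Sum>y<p j. f j y)"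
  by (simp add: residue_box_def prod_sum_PiE)

lemma sum_box_coordinate:
  fixes g :: "nat \<Rightarrow> real" and p :: "'n::finite \<Rightarrow> nat"
  shows "(\<Sum>m\<in>residue_box p. g (m j)) = real (cofactor p j) * (\<Sum>y<p j. g y)"
proof -
  have "(\<Sum>m\<in>residue_box p. g (m j)) = (\<Sum>m\<in>residue_box p. \<Prod>i\<in>UNIV. if i = j then g (m i) else 1)"
    by simp
  also have "\<dots> = (\<Prod>i\<in>UNIV. \<Sum>y<p i. if i = j then g y else 1)"
    by (rule sum_box_prod)
  also have "\<dots> = (\<Sum>y<p j. g y) * (\<Prod>i\<in>UNIV - {j}. \<Sum>y<p i. if i = j then g y else 1)"
    by (simp add: prod.remove[of UNIV j])
  also have "(\<Prod>i\<in>UNIV - {j}. \<Sum>y<p i. if i = j then g y else 1) = real (cofactor p j)"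
    unfolding cofactor_def of_nat_prod by (intro prod.cong) auto
  finally show ?thesis by simp
qed

lemma sum_box_two_coordinates:
  fixes g h :: "nat \<Rightarrow> real" and p :: "'n::finite \<Rightarrow> nat"
  assumes "j \<noteq> k"
  shows "(\<Sum>m\<in>residue_box p. g (m j) * h (m k))
       = (\<Prod>i\<in>UNIV - {j} - {k}. real (p i)) * (\<Sum>y<p j. g y) * (\<Sum>y<p k. h y)"
proof -
  let ?f = "\<lambda>i y. if i = j then g y else if i = k then h y else 1"
  have split: "(\<Prod>i\<in>UNIV. F i) = F j * (F k * (\<Prod>i\<in>UNIV - {j} - {k}. F i))" for F :: "'n \<Rightarrow> real"
    using assms by (subst prod.remove[of UNIV j], simp, simp, subst prod.remove[of "UNIV - {j}" k]) auto
  have rest: "(\<Prod>i\<in>UNIV - {j} - {k}. ?f i (m i)) = 1" for m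
    by (intro prod.neutral) auto
  have "(\<Sum>m\<in>residue_box p. g (m j) * h (m k)) = (\<Sum>m\<in>residue_box p. \<Prod>i\<in>UNIV. ?f i (m i))"
    unfolding split rest using assms by simp
  also have "\<dots> = (\<Prod>i\<in>UNIV. \<Sum>y<p i. ?f i y)"
    by (rule sum_box_prod)
  also have "\<dots> = (\<Sum>y<p j. g y) * ((\<Sum>y<p k. h y) * (\<Prod>i\<in>UNIV - {j} - {k}. \<Sum>y<p i. ?f i y))"
    unfolding split using assms by simp
  also have "(\<Prod>i\<in>UNIV - {j} - {k}. \<Sum>y<p i. ?f i y) = (\<Prod>i\<in>UNIV - {j} - {k}. real (p i))"
    by (intro prod.cong) auto
  finally show ?thesis by simp
qed

section \<open>The Chinese remainder bijection\<close>

text \<open>The numerator of \<open>\<Sum>\<^sub>j m\<^sub>j / p\<^sub>j\<close> over the common denominator \<open>\<Prod>\<^sub>j p\<^sub>j\<close>, by \<open>weight_div\<close>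
  below.\<close>

definition weight :: "('n::finite \<Rightarrow> nat) \<Rightarrow> ('n \<Rightarrow> nat) \<Rightarrow> nat" where
  "weight p m = (\<Sum>j\<in>UNIV. m j * cofactor p j)"

lemma weight_div:
  assumes "\<And>j. p j > 0"
  shows "real (weight p m) / real (\<Prod>j\<in>UNIV. p j) = (\<Sum>j\<in>UNIV. real (m j) / real (p j))"
proof -
  have c: "cofactor p j > 0" for j
    unfolding cofactor_def using assms by (simp add: prod_pos)
  have "real (m j * cofactor p j) / real (\<Prod>j\<in>UNIV. p j) = real (m j) / real (p j)" for j
    using assms[of j] c[of j] by (simp add: prod_eq_mult_cofactor[of p j] del: of_nat_prod)
  then show ?thesis
    unfolding weight_def by (simp add: sum_divide_distrib)
qed

text \<open>All cofactors but the \<open>j\<close>-th are divisible by \<open>p j\<close>, so modulo \<open>p j\<close> the weight sees only the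
  \<open>j\<close>-th coordinate.\<close>

lemma weight_cong: "[weight p m = m j * cofactor p j] (mod p j)"
proof -
  have "p j dvd (\<Sum>i\<in>UNIV - {j}. m i * cofactor p i)"
    unfolding cofactor_def by (intro dvd_sum dvd_mult dvd_prodI) auto
  then show ?thesis
    by (auto simp: weight_def sum.remove[of UNIV j] cong_def elim!: dvdE)
qed

lemma coprime_cofactor:
  assumes "\<And>i k. i \<noteq> k \<Longrightarrow> coprime (p i) (p k)"
  shows "coprime (cofactor p j) (p j)"
  unfolding cofactor_def using assms by (intro prod_coprime_left) auto

text \<open>The \<open>j\<close>-th cofactor is a unit modulo \<open>p j\<close>, so the residue of the weight determines the \<open>j\<close>-th
  coordinate.\<close>

lemma weight_cong_iff:
  assumes cop: "\<And>i k. i \<noteq> k \<Longrightarrow> coprime (p i) (p k)" and "m j < p j" "y < p j"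
  shows "weight p m mod p j = y * cofactor p j mod p j \<longleftrightarrow> m j = y"
proof -
  have "weight p m mod p j = y * cofactor p j mod p j
      \<longleftrightarrow> [m j * cofactor p j = y * cofactor p j] (mod p j)"
    using weight_cong[of p m j] by (simp add: cong_def)
  also have "\<dots> \<longleftrightarrow> [m j = y] (mod p j)"
    using coprime_cofactor[of p j] cop by (simp add: cong_mult_rcancel_nat coprime_commute)
  also have "\<dots> \<longleftrightarrow> m j = y"
    using assms by (auto simp: cong_def)
  finally show ?thesis .
qed

text \<open>The Chinese remainder theorem: the residue modulo \<open>P\<close> determines the residue modulo each \<open>p j\<close>,
  hence each coordinate, and both sides have \<open>P\<close> elements.\<close>

lemma bij_betw_weight_mod:
  fixes p :: "'n::finite \<Rightarrow> nat"
  assumes pos: "\<And>j. p j > 0" and cop: "\<And>i k. i \<noteq> k \<Longrightarrow> coprime (p i) (p k)"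
  defines "P \<equiv> \<Prod>j\<in>UNIV. p j"
  shows "bij_betw (\<lambda>m. weight p m mod P) (residue_box p) {..<P}"
proof -
  have "P > 0" using pos by (simp add: P_def prod_pos)
  have inj: "inj_on (\<lambda>m. weight p m mod P) (residue_box p)"
  proof (rule inj_onI, rule ext)
    fix m m' j assume m: "m \<in> residue_box p" "m' \<in> residue_box p" and eq: "weight p m mod P = weight p m' mod P"
    have "p j dvd P" unfolding P_def by (simp add: dvd_prodI)
    then have "weight p m mod p j = weight p m' mod p j"
      using eq by (metis mod_mod_cancel)
    also have "\<dots> = m' j * cofactor p j mod p j"
      using weight_cong by (simp add: cong_def)
    finally show "m j = m' j"
      using weight_cong_iff[of p m j "m' j"] cop m by (auto simp: in_residue_box_iff)
  qed
  have "(\<lambda>m. weight p m mod P) ` residue_box p = {..<P}"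
    using inj \<open>P > 0\<close> by (intro card_subset_eq) (auto simp: card_image card_residue_box P_def)
  with inj show ?thesis by (simp add: bij_betw_def)
qed

section \<open>The periodic Bernoulli function\<close>

text \<open>The first Bernoulli polynomial \<open>x - 1/2\<close>, made periodic, at \<open>x = - k / a\<close>. The minus sign is there
  because rounding up adds \<open>frac (- x)\<close> to \<open>x\<close>. In contrast to \<open>sawtooth\<close> the value at
  integers is \<open>- 1/2\<close>.\<close>

definition bern :: "nat \<Rightarrow> nat \<Rightarrow> real" where
  "bern a k = frac (- (real k / real a)) - 1/2"

lemma bern_less:
  assumes "k < a"
  shows "bern a k = (if k = 0 then - 1/2 else 1/2 - real k / real a)"
proof (cases "k = 0")
  case False
  then have "frac (- (real k / real a)) = 1 - real k / real a"
    using assms by (subst frac_unique_iff) (auto simp: field_simps)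
  then show ?thesis using False by (simp add: bern_def)
qed (simp add: bern_def)

lemma bern_mod: "bern a (k mod a) = bern a k"
proof (cases "a = 0")
  case False
  have "real k / real a = real (k mod a) / real a + real (k div a)"
    using False by (simp add: field_simps flip: of_nat_mult of_nat_add)
  then have "- (real (k mod a) / real a) = - (real k / real a) + of_int (int (k div a))"
    by simp
  then have "frac (- (real (k mod a) / real a)) = frac (- (real k / real a))"
    by (simp only: frac_add_int_right Ints_of_int)
  then show ?thesis by (simp add: bern_def)
qed simp

lemma sum_real_lessThan: "(\<Sum>y<n. real y) = real n * (real n - 1) / 2"
  by (induction n) (auto simp: field_simps)

lemma sum_real_square_lessThan: "(\<Sum>y<n. (real y)\<^sup>2) = real n * (real n - 1) * (2 * real n - 1) / 6"
  by (induction n) (auto simp: field_simps power2_eq_square)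

lemma sum_centered:
  assumes "a > 0"
  shows "(\<Sum>y<a. real y / real a - 1/2) = - 1/2"
proof -
  have "(\<Sum>y<a. real y / real a - 1/2) = (\<Sum>y<a. real y) / real a - real a / 2"
    by (simp add: sum_subtractf sum_divide_distrib)
  then show ?thesis using assms unfolding sum_real_lessThan by (simp add: field_simps)
qed

lemma sum_centered_square:
  assumes "a > 0"
  shows "(\<Sum>y<a. (real y / real a - 1/2)\<^sup>2) = real a / 12 + 1 / (6 * real a)"
proof -
  have "(\<Sum>y<a. (real y / real a - 1/2)\<^sup>2)
      = (\<Sum>y<a. (real y)\<^sup>2 / (real a)\<^sup>2 - real y / real a + 1/4)"
    by (intro sum.cong) (auto simp: power2_eq_square algebra_simps)
  also have "\<dots> = (\<Sum>y<a. (real y)\<^sup>2) / (real a)\<^sup>2 - (\<Sum>y<a. real y) / real a + real a / 4"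
    by (simp add: sum.distrib sum_subtractf sum_divide_distrib)
  also have "\<dots> = real a / 12 + 1 / (6 * real a)"
    using assms unfolding sum_real_lessThan sum_real_square_lessThan
    by (simp add: field_simps power2_eq_square)
  finally show ?thesis .
qed

lemma sum_bern_square:
  assumes "a > 0"
  shows "(\<Sum>k<a. (bern a k)\<^sup>2) = real a / 12 + 1 / (6 * real a)"
proof -
  have "(bern a k)\<^sup>2 = (real k / real a - 1/2)\<^sup>2" if "k < a" for k
    using that by (auto simp: bern_less power2_eq_square algebra_simps)
  then show ?thesis using sum_centered_square[OF assms] by simp
qed

text \<open>The multiplication formula of the periodic Bernoulli function. Since the arguments
  \<open>r + a * q\<close> lie in a single period, it is the sum of an arithmetic progression, corrected by \<open>1\<close>
  for the argument \<open>0\<close>, where the function jumps.\<close>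

lemma sum_bern_progression:
  assumes "r < a" "b > 0"
  shows "(\<Sum>q<b. bern (a * b) (r + a * q)) = bern a r"
proof -
  have a: "a > 0" using assms by simp
  have "bern (a * b) (r + a * q)
      = (1/2 - real r / real (a * b) - real q / real b) - (if q = 0 then of_bool (r = 0) else 0)"
    if "q < b" for q
  proof -
    have "r + a * q < a * Suc q" using assms by simp
    also have "\<dots> \<le> a * b" using that by (intro mult_left_mono) auto
    finally have "bern (a * b) (r + a * q) =
      (if r + a * q = 0 then - 1/2 else 1/2 - real (r + a * q) / real (a * b))"
      by (rule bern_less)
    then show ?thesis using a assms by (auto simp: field_simps)
  qed
  then have "(\<Sum>q<b. bern (a * b) (r + a * q))
     = (\<Sum>q<b. (1/2 - real r / real (a * b) - real q / real b) - (if q = 0 then of_bool (r = 0) else 0))"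
    by (intro sum.cong) auto
  also have "\<dots> = real b * (1/2 - real r / real (a * b)) - (\<Sum>q<b. real q) / real b - of_bool (r = 0)"
    using assms by (simp add: sum_subtractf sum_divide_distrib)
  also have "\<dots> = bern a r"
    using assms unfolding sum_real_lessThan by (simp add: bern_less field_simps)
  finally show ?thesis .
qed

text \<open>Away from \<open>y = 0\<close> no argument is an integer, so \<open>bern\<close> is minus the sawtooth function, by its
  oddness. The term \<open>1/4\<close> is the contribution of \<open>y = 0\<close>, where both factors are \<open>- 1/2\<close> while the
  sawtooth vanishes.\<close>

lemma sum_centered_bern:
  assumes a: "a \<ge> 1" and cop: "coprime b a"
  shows "(\<Sum>y<a. (real y / real a - 1/2) * bern a (y * b)) = 1/4 - dedekind_sum b a"
proof -
  have "sawtooth (real y / real a) * sawtooth (real y * real b / real a)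
      = - ((real y / real a - 1/2) * bern a (y * b))" if y: "y \<in> {1..a-1}" for y
  proof -
    have "\<not> a dvd y" using y by (auto dest: dvd_imp_le)
    then have nd: "\<not> a dvd y * b" using cop by (simp add: coprime_dvd_mult_left_iff coprime_commute)
    have notint: "real x / real a \<notin> \<int>" if "\<not> a dvd x" for x
      using that a of_int_div_of_int_in_Ints_iff[of "int x" "int a", where ?'a = real] by simp
    have "frac (real y / real a) = real y / real a"
      using y by (subst frac_eq) auto
    then have "sawtooth (real y / real a) = real y / real a - 1/2"
      using notint[OF \<open>\<not> a dvd y\<close>] by (simp add: sawtooth_def frac_def)
    moreover have "sawtooth (real y * real b / real a) = - bern a (y * b)"
      using notint[OF nd] by (simp add: sawtooth_def bern_def frac_neg) (simp add: frac_def)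
    ultimately show ?thesis by simp
  qed
  then have "dedekind_sum b a = - (\<Sum>y\<in>{1..a-1}. (real y / real a - 1/2) * bern a (y * b))"
    unfolding dedekind_sum_def by (simp add: sum_negf)
  moreover have "{..<a} = insert 0 {1..a-1}" using a by auto
  ultimately show ?thesis using a by (simp add: bern_less)
qed

section \<open>The Ehrhart polynomial as a sum over the box\<close>

text \<open>For the induction the functions live on a subset \<open>S\<close> and vanish elsewhere. Splitting off the value
  at one new point leads to the hockey-stick identity for binomial coefficients.\<close>

lemma functions_sum_le_card:
  assumes "finite S"
  shows "finite {q :: 'a \<Rightarrow> nat. (\<forall>i. i \<notin> S \<longrightarrow> q i = 0) \<and> sum q S \<le> N} \<and>
    card {q :: 'a \<Rightarrow> nat. (\<forall>i. i \<notin> S \<longrightarrow> q i = 0) \<and> sum q S \<le> N} = (N + card S) choose card S"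
  using assms
proof (induction S arbitrary: N rule: finite_induct)
  case empty
  have "{q :: 'a \<Rightarrow> nat. \<forall>i. q i = 0} = {\<lambda>i. 0}" by auto
  then show ?case by simp
next
  case (insert a S)
  define Q where "Q S N = {q :: 'a \<Rightarrow> nat. (\<forall>i. i \<notin> S \<longrightarrow> q i = 0) \<and> sum q S \<le> N}" for S N
  have IH: "finite (Q S n)" "card (Q S n) = (n + card S) choose card S" for n
    using insert.IH by (auto simp: Q_def)
  have upd: "(\<Sum>i\<in>S. if i = a then x else q i) = sum q S" for q :: "'a \<Rightarrow> nat" and x
    using insert.hyps by (intro sum.cong) auto
  have bij: "bij_betw (\<lambda>(x, q). q(a := x)) (SIGMA x:{..N}. Q S (N - x)) (Q (insert a S) N)"
    by (rule bij_betw_byWitness[where f' = "\<lambda>q. (q a, q(a := 0))"])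
      (use insert.hyps in \<open>auto simp: Q_def upd fun_eq_iff fun_upd_def\<close>)
  have "finite (Q (insert a S) N)"
    using bij_betw_finite[OF bij] IH(1) by auto
  moreover have "card (Q (insert a S) N) = (\<Sum>x\<le>N. (N - x + card S) choose card S)"
    using bij_betw_same_card[OF bij] IH by simp
  moreover have "(\<Sum>x\<le>N. (N - x + card S) choose card S) = (\<Sum>x\<le>N. (x + card S) choose card S)"
    by (rule sum.reindex_bij_witness[of _ "\<lambda>x. N - x" "\<lambda>x. N - x"]) auto
  moreover have "(\<Sum>x\<le>N. (x + k) choose k) = (N + Suc k) choose Suc k" for k
    by (induction N) auto
  ultimately show ?case
    using insert.hyps by (simp add: Q_def)
qed

text \<open>The rising factorial counts correctly even for slightly negative \<open>z\<close>: there are no functions then,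
  and its zeros are exactly \<open>z = - 1, \<dots>, - M\<close>. This makes the lattice point count
  polynomial for every \<open>t > 0\<close>, without exceptions for small \<open>t\<close>.\<close>

lemma card_functions_sum_le:
  fixes z :: int
  assumes "z \<ge> - int CARD('n)"
  shows "real (card {q :: 'n::finite \<Rightarrow> nat. int (sum q UNIV) \<le> z})
       = pochhammer (of_int z + 1) CARD('n) / fact CARD('n)"
proof (cases "z \<ge> 0")
  case True
  then obtain N where z: "z = int N" using nonneg_int_cases by blast
  have "card {q :: 'n \<Rightarrow> nat. sum q UNIV \<le> N} = (N + CARD('n)) choose CARD('n)"
    using functions_sum_le_card[of "UNIV :: 'n set" N] by simp
  moreover have "real ((N + CARD('n)) choose CARD('n)) = pochhammer (real N + 1) CARD('n) / fact CARD('n)"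
    by (simp add: binomial_gbinomial gbinomial_pochhammer')
  ultimately show ?thesis by (simp add: z del: of_nat_sum)
next
  case False
  then have none: "{q :: 'n \<Rightarrow> nat. int (sum q UNIV) \<le> z} = {}"
    by (smt (verit) empty_Collect_eq of_nat_0_le_iff)
  have "real_of_int z + 1 = - real (nat (- z - 1))" "nat (- z - 1) < CARD('n)"
    using False assms by auto
  then have "pochhammer (real_of_int z + 1) CARD('n) = 0"
    unfolding pochhammer_eq_0_iff by blast
  then show ?thesis using none by simp
qed

definition level :: "('n::finite \<Rightarrow> nat) \<Rightarrow> ('n \<Rightarrow> nat) \<Rightarrow> int" where
  "level p m = \<lceil>\<Sum>j\<in>UNIV. real (m j) / real (p j)\<rceil>"

lemma level_le_card:
  fixes p :: "'n::finite \<Rightarrow> nat"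
  assumes "m \<in> residue_box p"
  shows "level p m \<le> int CARD('n)"
proof -
  have "(\<Sum>j\<in>UNIV. real (m j) / real (p j)) \<le> (\<Sum>j\<in>(UNIV :: 'n set). 1)"
    using assms by (intro sum_mono) (auto simp: in_residue_box_iff divide_le_eq_1 less_imp_le)
  then show ?thesis by (simp add: level_def ceiling_le_iff)
qed

text \<open>Division with remainder in every coordinate splits a lattice point into a remainder \<open>m\<close> in the box
  and a quotient \<open>q\<close>. The quotient enters the inequality only through the integer \<open>\<Sum>\<^sub>j q\<^sub>j\<close>, so
  \<open>\<Sum>\<^sub>j m\<^sub>j / p\<^sub>j\<close> may be rounded up.\<close>

lemma lattice_count_box:
  fixes p :: "'n::finite \<Rightarrow> nat"
  assumes pos: "\<And>j. p j > 0" and t: "t > 0"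
  shows "real (lattice_count (tetrahedron p) t)
       = (\<Sum>m\<in>residue_box p. pochhammer (real t - of_int (level p m) + 1) CARD('n) / fact CARD('n))"
proof -
  let ?L = "{x :: int ^ 'n. (\<forall>k. x $ k \<ge> 0) \<and> (\<Sum>j\<in>UNIV. of_int (x $ j) / real (p j)) \<le> real t}"
  define Q where "Q m = {q :: 'n \<Rightarrow> nat. int (sum q UNIV) \<le> int t - level p m}" for m
  define F where "F = (\<lambda>(m, q). (\<chi> j. int (m j + p j * q j)) :: int ^ 'n)"
  have F: "F (m, q) \<in> ?L \<longleftrightarrow> q \<in> Q m" for m q
  proof -
    have "real (m j + p j * q j) / real (p j) = real (m j) / real (p j) + real (q j)" for j
      using pos[of j] by (simp add: field_simps)
    then have "(\<Sum>j\<in>UNIV. real_of_int (F (m, q) $ j) / real (p j))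
        = (\<Sum>j\<in>UNIV. real (m j) / real (p j)) + real (sum q UNIV)"
      by (simp add: F_def sum.distrib)
    then have "F (m, q) \<in> ?L \<longleftrightarrow>
        (\<Sum>j\<in>UNIV. real (m j) / real (p j)) \<le> of_int (int t - int (sum q UNIV))"
      by (simp add: F_def le_diff_eq)
    also have "\<dots> \<longleftrightarrow> level p m \<le> int t - int (sum q UNIV)"
      by (simp only: level_def ceiling_le_iff)
    finally show ?thesis
      by (auto simp: Q_def simp del: of_nat_sum)
  qed
  have "bij_betw F (SIGMA m:residue_box p. Q m) ?L"
  proof (rule bij_betw_byWitness[where f' = "\<lambda>x. (\<lambda>j. nat (x $ j) mod p j, \<lambda>j. nat (x $ j) div p j)"])
    have "nat (int (m j + p j * q j)) mod p j = m j \<and> nat (int (m j + p j * q j)) div p j = q j"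
      if "m j < p j" for m q j
      using that by (simp del: of_nat_add of_nat_mult)
    then show "\<forall>a\<in>SIGMA m:residue_box p. Q m.
        (\<lambda>j. nat (F a $ j) mod p j, \<lambda>j. nat (F a $ j) div p j) = a"
      by (auto simp: F_def in_residue_box_iff fun_eq_iff simp del: nat_int)
    have inv: "F (\<lambda>j. nat (x $ j) mod p j, \<lambda>j. nat (x $ j) div p j) = x" if "x \<in> ?L" for x
      using that by (simp add: F_def vec_eq_iff del: of_nat_add of_nat_mult)
    then show "\<forall>x\<in>?L. F (\<lambda>j. nat (x $ j) mod p j, \<lambda>j. nat (x $ j) div p j) = x" by blast
    show "F ` (SIGMA m:residue_box p. Q m) \<subseteq> ?L" using F by blast
    show "(\<lambda>x. (\<lambda>j. nat (x $ j) mod p j, \<lambda>j. nat (x $ j) div p j)) ` ?L \<subseteq> (SIGMA m:residue_box p. Q m)"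
    proof (rule image_subsetI)
      fix x assume x: "x \<in> ?L"
      then have "F (\<lambda>j. nat (x $ j) mod p j, \<lambda>j. nat (x $ j) div p j) \<in> ?L"
        using inv by simp
      then show "(\<lambda>j. nat (x $ j) mod p j, \<lambda>j. nat (x $ j) div p j) \<in> (SIGMA m:residue_box p. Q m)"
        using F pos by (simp add: in_residue_box_iff)
    qed
  qed
  then have "lattice_count (tetrahedron p) t = card (SIGMA m:residue_box p. Q m)"
    using lattice_count_tetrahedron[of p t] pos t by (simp add: bij_betw_same_card)
  also have "\<dots> = (\<Sum>m\<in>residue_box p. card (Q m))"
  proof (rule card_SigmaI)
    have "Q m \<subseteq> {q. sum q UNIV \<le> nat (int t - level p m)}" for m
      by (auto simp: Q_def nat_le_iff le_nat_iff simp del: of_nat_sum)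
    then show "\<forall>m\<in>residue_box p. finite (Q m)"
      using functions_sum_le_card[of "UNIV :: 'n set"] by (auto intro: finite_subset)
  qed simp
  finally have "real (lattice_count (tetrahedron p) t) = (\<Sum>m\<in>residue_box p. real (card (Q m)))"
    by simp
  also have "\<dots> = (\<Sum>m\<in>residue_box p.
      pochhammer (real t - of_int (level p m) + 1) CARD('n) / fact CARD('n))"
  proof (rule sum.cong[OF refl])
    fix m assume "m \<in> residue_box p"
    then have "int t - level p m \<ge> - int CARD('n)" using level_le_card[of m p] by simp
    then show "real (card (Q m)) = pochhammer (real t - of_int (level p m) + 1) CARD('n) / fact CARD('n)"
      unfolding Q_def by (subst card_functions_sum_le) simp_all
  qed
  finally show ?thesis .
qed

text \<open>A polynomial is determined by its values at infinitely many points.\<close>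

lemma ehrhart_poly_eqI:
  assumes "\<And>t. t > 0 \<Longrightarrow> poly E (real t) = real (lattice_count S t)"
  shows "ehrhart_poly S = E"
  unfolding ehrhart_poly_def
proof (rule the_equality)
  fix E' assume "\<forall>t>0. poly E' (real t) = real (lattice_count S t)"
  then have sub: "real ` {0<..} \<subseteq> {x. poly (E' - E) x = 0}"
    using assms by auto
  have "infinite (real ` {0<..})"
    by (simp add: finite_image_iff infinite_Ioi)
  then show "E' = E"
    using sub poly_roots_finite[of "E' - E"] finite_subset by auto
qed (use assms in auto)

lemma ehrhart_poly_tetrahedron:
  fixes p :: "'n::finite \<Rightarrow> nat"
  assumes "\<And>j. p j > 0"
  shows "ehrhart_poly (tetrahedron p)
       = (\<Sum>m\<in>residue_box p. smult (1 / fact CARD('n)) (\<Prod>i<CARD('n). [:real i + 1 - of_int (level p m), 1:]))"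
  using lattice_count_box[of p] assms
  by (intro ehrhart_poly_eqI)
    (simp add: poly_sum poly_prod pochhammer_prod atLeast0LessThan algebra_simps)

text \<open>The three top coefficients of a product of monic linear factors are elementary symmetric functions;
  the one of degree two is written by power sums, which is the form in which it is evaluated below. The
  four parts are proved by one induction because each of the last three uses its predecessor.\<close>

lemma coeffs_prod_linear:
  fixes a :: "'a \<Rightarrow> 'b::idom"
  assumes "finite I"
  shows "\<forall>n > card I. coeff (\<Prod>i\<in>I. [:a i, 1:]) n = 0"
    and "coeff (\<Prod>i\<in>I. [:a i, 1:]) (card I) = 1"
    and "\<forall>n. card I = n + 1 \<longrightarrow> coeff (\<Prod>i\<in>I. [:a i, 1:]) n = sum a I"
    and "\<forall>n. card I = n + 2 \<longrightarrow>
      2 * coeff (\<Prod>i\<in>I. [:a i, 1:]) n = (sum a I)\<^sup>2 - (\<Sum>i\<in>I. (a i)\<^sup>2)"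
  using assms
proof (induction I rule: finite_induct)
  case empty
  case 1 show ?case by simp
  case 2 show ?case by simp
  case 3 show ?case by simp
  case 4 show ?case by simp
next
  case (insert b I)
  let ?Q = "\<Prod>i\<in>I. [:a i, 1:]"
  have step: "(\<Prod>i\<in>insert b I. [:a i, 1:]) = smult (a b) ?Q + pCons 0 ?Q"
    using insert.hyps by simp
  case 1 show ?case
    unfolding step using insert by (auto simp: coeff_pCons split: nat.split)
  case 2 show ?case
    unfolding step using insert by (auto simp: coeff_pCons)
  case 3 show ?case
    unfolding step using insert by (auto simp: coeff_pCons split: nat.split)
  case 4 show ?case
  proof (intro allI impI)
    fix n assume "card (insert b I) = n + 2"
    then have c: "card I = n + 1" using insert.hyps by simp
    have "2 * coeff (pCons 0 ?Q) n = (sum a I)\<^sup>2 - (\<Sum>i\<in>I. (a i)\<^sup>2)"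
    \<comment> \<open>For \<open>n = 0\<close> there is a single factor and the shifted coefficient vanishes, as does the right-hand side.\<close>
    proof (cases n)
      case 0
      then obtain i where "I = {i}" using c by (auto simp: card_1_singleton_iff)
      then show ?thesis using 0 by simp
    next
      case (Suc k)
      then show ?thesis using insert.IH(4) c by simp
    qed
    moreover have "coeff ?Q n = sum a I" using insert.IH(3) c by simp
    ultimately show "2 * coeff (\<Prod>i\<in>insert b I. [:a i, 1:]) n
        = (sum a (insert b I))\<^sup>2 - (\<Sum>i\<in>insert b I. (a i)\<^sup>2)"
      unfolding step using insert.hyps by (simp add: algebra_simps power2_eq_square)
  qed
qed

text \<open>The sum and the sum of squares of the \<open>M\<close> consecutive numbers \<open>1 - c, \<dots>, M - c\<close> depend on \<open>c\<close> only
  through the distance from \<open>c\<close> to the centre \<open>(M + 1) / 2\<close>.\<close>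

lemma coeff_shifted_binomial:
  assumes "M \<ge> 2"
  shows "fact (M - 2) * coeff (smult (1 / fact M) (\<Prod>i<M. [:real i + 1 - c, 1:])) (M - 2)
       = (c - (real M + 1) / 2)\<^sup>2 / 2 - (real M + 1) / 24"
proof -
  let ?a = "\<lambda>i. real i + 1 - c"
  obtain n where n: "M = n + 2" using assms by (metis add.commute le_Suc_ex)
  have s1: "sum ?a {..<M} = real M * (real M - 1) / 2 + real M * (1 - c)"
    using sum_real_lessThan[of M] by (simp add: sum.distrib sum_subtractf algebra_simps)
  have "(\<Sum>i<M. (?a i)\<^sup>2) = (\<Sum>i<M. (real i)\<^sup>2 + 2 * (1 - c) * real i + (1 - c)\<^sup>2)"
    by (intro sum.cong) (auto simp: power2_eq_square algebra_simps)
  also have "\<dots> = (\<Sum>i<M. (real i)\<^sup>2) + 2 * (1 - c) * (\<Sum>i<M. real i) + real M * (1 - c)\<^sup>2"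
    by (simp add: sum.distrib sum_distrib_left)
  finally have s2: "(\<Sum>i<M. (?a i)\<^sup>2) = real M * (real M - 1) * (2 * real M - 1) / 6
      + 2 * (1 - c) * (real M * (real M - 1) / 2) + real M * (1 - c)\<^sup>2"
    unfolding sum_real_lessThan sum_real_square_lessThan .
  have "2 * coeff (\<Prod>i<M. [:?a i, 1:]) n = (sum ?a {..<M})\<^sup>2 - (\<Sum>i<M. (?a i)\<^sup>2)"
    using coeffs_prod_linear(4)[of "{..<M}" ?a] n by simp
  also have "\<dots> = real M * (real M - 1) * ((c - (real M + 1) / 2)\<^sup>2 - (real M + 1) / 12)"
    unfolding s1 s2 by (simp add: field_simps power2_eq_square)
  finally have co: "coeff (\<Prod>i<M. [:?a i, 1:]) n
      = real M * (real M - 1) * ((c - (real M + 1) / 2)\<^sup>2 - (real M + 1) / 12) / 2"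
    by simp
  have f: "fact M = real M * (real M - 1) * fact n"
    unfolding n by (simp add: algebra_simps)
  have "fact (M - 2) * coeff (smult (1 / fact M) (\<Prod>i<M. [:?a i, 1:])) (M - 2)
      = fact n * (1 / (real M * (real M - 1) * fact n)
          * (real M * (real M - 1) * ((c - (real M + 1) / 2)\<^sup>2 - (real M + 1) / 12) / 2))"
    unfolding coeff_smult f[symmetric] co[symmetric] using n by simp
  also have "\<dots> = ((c - (real M + 1) / 2)\<^sup>2 - (real M + 1) / 12) / 2"
  proof -
    have "real M * (real M - 1) \<noteq> 0" using n by simp
    then have "f * (1 / (real M * (real M - 1) * f) * (real M * (real M - 1) * x / 2)) = x / 2"
      if "f \<noteq> 0" for f x :: real
      using that by (simp add: divide_simps)
    then show ?thesis by simp
  qed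
  finally show ?thesis by simp
qed

section \<open>Second moments over the box\<close>

text \<open>The weights of the points with \<open>m j = y\<close> run, modulo \<open>P\<close>, over the arithmetic progression of all
  residues that are congruent to \<open>y * cofactor p j\<close> modulo \<open>p j\<close>. The multiplication formula
  evaluates the sum of \<open>bern\<close> over this progression.\<close>

lemma bern_cross_moment:
  fixes p :: "'n::finite \<Rightarrow> nat" and g :: "nat \<Rightarrow> real"
  assumes pos: "\<And>j. p j > 0" and cop: "\<And>i k. i \<noteq> k \<Longrightarrow> coprime (p i) (p k)"
  defines "P \<equiv> \<Prod>j\<in>UNIV. p j"
  shows "(\<Sum>m\<in>residue_box p. g (m j) * bern P (weight p m))
       = (\<Sum>y<p j. g y * bern (p j) (y * cofactor p j))"
proof -
  have P: "P = p j * cofactor p j" unfolding P_def by (rule prod_eq_mult_cofactor)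
  have A: "cofactor p j > 0" using pos by (simp add: cofactor_def prod_pos)
  note bij = bij_betw_weight_mod[of p, OF pos cop, folded P_def]
  have fibre: "(\<Sum>m\<in>{m \<in> residue_box p. m j = y}. bern P (weight p m)) = bern (p j) (y * cofactor p j)"
    if y: "y < p j" for y
  proof -
    define r where "r = y * cofactor p j mod p j"
    have r: "r < p j" using pos by (simp add: r_def)
    have modP: "weight p m mod P mod p j = weight p m mod p j" for m
      by (simp add: P mod_mod_cancel)
    have "bij_betw (\<lambda>m. weight p m mod P) {m \<in> residue_box p. m j = y} {k \<in> {..<P}. k mod p j = r}"
    proof (rule bij_betw_subset[OF bij])
      have "m j = y \<longleftrightarrow> weight p m mod P mod p j = r" if "m \<in> residue_box p" for m
        using weight_cong_iff[of p m j y] cop that y by (auto simp: r_def modP in_residue_box_iff)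
      then have "{m \<in> residue_box p. m j = y} = {m \<in> residue_box p. weight p m mod P \<in> {k. k mod p j = r}}"
        by auto
      moreover have "(\<lambda>m. weight p m mod P) ` residue_box p = {..<P}"
        using bij by (simp add: bij_betw_def)
      ultimately show "(\<lambda>m. weight p m mod P) ` {m \<in> residue_box p. m j = y} = {k \<in> {..<P}. k mod p j = r}"
        by auto
    qed auto
    then have "(\<Sum>m\<in>{m \<in> residue_box p. m j = y}. bern P (weight p m mod P))
        = (\<Sum>k\<in>{k \<in> {..<P}. k mod p j = r}. bern P k)"
      by (rule sum.reindex_bij_betw)
    also have "\<dots> = (\<Sum>q<cofactor p j. bern P (r + p j * q))"
    proof (rule sum.reindex_bij_witness[of _ "\<lambda>q. r + p j * q" "\<lambda>k. k div p j"])
      fix q assume q: "q \<in> {..<cofactor p j}"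
      have "r + p j * q < p j * Suc q" using r by simp
      also have "\<dots> \<le> P" unfolding P using q by (intro mult_left_mono) auto
      finally show "r + p j * q \<in> {k \<in> {..<P}. k mod p j = r}" using r by simp
    next
      fix k assume "k \<in> {k \<in> {..<P}. k mod p j = r}"
      then show "k div p j \<in> {..<cofactor p j}" "r + p j * (k div p j) = k"
        by (auto simp: P less_mult_imp_div_less mult.commute)
      then show "bern P (r + p j * (k div p j)) = bern P k" by simp
    qed (use r in auto)
    also have "\<dots> = bern (p j) r"
      unfolding P using r A by (rule sum_bern_progression)
    finally show ?thesis by (simp add: bern_mod r_def)
  qed
  have "(\<Sum>m\<in>residue_box p. g (m j) * bern P (weight p m))
      = (\<Sum>y<p j. \<Sum>m\<in>{m \<in> residue_box p. m j = y}. g (m j) * bern P (weight p m))"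
    by (rule sum.group[symmetric]) (auto simp: in_residue_box_iff)
  also have "\<dots> = (\<Sum>y<p j. g y * (\<Sum>m\<in>{m \<in> residue_box p. m j = y}. bern P (weight p m)))"
    by (simp add: sum_distrib_left)
  also have "\<dots> = (\<Sum>y<p j. g y * bern (p j) (y * cofactor p j))"
    by (intro sum.cong) (auto simp: fibre)
  finally show ?thesis .
qed

lemma bern_second_moment:
  fixes p :: "'n::finite \<Rightarrow> nat"
  assumes pos: "\<And>j. p j > 0" and cop: "\<And>i k. i \<noteq> k \<Longrightarrow> coprime (p i) (p k)"
  defines "P \<equiv> \<Prod>j\<in>UNIV. p j"
  shows "(\<Sum>m\<in>residue_box p. (bern P (weight p m))\<^sup>2) = real P / 12 + 1 / (6 * real P)"
proof -
  have "P > 0" using pos by (simp add: P_def prod_pos)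
  have "(\<Sum>m\<in>residue_box p. (bern P (weight p m mod P))\<^sup>2) = (\<Sum>k<P. (bern P k)\<^sup>2)"
    by (rule sum.reindex_bij_betw[OF bij_betw_weight_mod[of p, OF pos cop, folded P_def]])
  then show ?thesis using sum_bern_square[OF \<open>P > 0\<close>] by (simp add: bern_mod)
qed

text \<open>The point of centring: \<open>(M + 1) / 2\<close> is shared out as \<open>1/2\<close> to each of the \<open>M\<close> coordinates and \<open>1/2\<close>
  to the fractional part added by rounding up, so that every summand becomes a Bernoulli
  function.\<close>

lemma centered_level:
  fixes p :: "'n::finite \<Rightarrow> nat"
  assumes "\<And>j. p j > 0"
  shows "of_int (level p m) - (real CARD('n) + 1) / 2
       = (\<Sum>j\<in>UNIV. real (m j) / real (p j) - 1/2) + bern (\<Prod>j\<in>UNIV. p j) (weight p m)"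
proof -
  have "real_of_int \<lceil>x\<rceil> = x + frac (- x)" for x :: real
    by (simp add: frac_def ceiling_def)
  then show ?thesis
    using weight_div[of p m] assms
    by (simp add: level_def bern_def sum_subtractf add_divide_distrib del: of_nat_prod)
qed

text \<open>Different coordinates are independent and each centred coordinate sums to \<open>- 1/2\<close> over its range, which gives the
  off-diagonal terms.\<close>

lemma centered_coordinates_second_moment:
  fixes p :: "'n::finite \<Rightarrow> nat"
  assumes pos: "\<And>j. p j > 0"
  defines "P \<equiv> \<Prod>j\<in>UNIV. p j"
  shows "(\<Sum>m\<in>residue_box p. (\<Sum>j\<in>UNIV. real (m j) / real (p j) - 1/2)\<^sup>2)
       = real CARD('n) * real P / 12 + (\<Sum>j\<in>UNIV. (real (cofactor p j))\<^sup>2) / (6 * real P)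
         + ((\<Sum>j\<in>UNIV. real (cofactor p j))\<^sup>2 - (\<Sum>j\<in>UNIV. (real (cofactor p j))\<^sup>2)) / (4 * real P)"
proof -
  let ?x = "\<lambda>m j. real (m j) / real (p j) - 1/2"
  let ?A = "\<lambda>j. real (cofactor p j)"
  have P0: "real P > 0" using pos by (simp add: P_def prod_pos)
  have PA: "real P = real (p j) * ?A j" for j
    unfolding P_def prod_eq_mult_cofactor[of p j] by simp
  have p0: "real (p j) > 0" for j using pos by simp
  \<comment> \<open>The off-diagonal value is split off, so that the double sum below completes to a full square.\<close>
  have diag: "(\<Sum>m\<in>residue_box p. ?x m j * ?x m j)
      = ?A j * ?A j / (4 * real P) + (real P / 12 - (?A j)\<^sup>2 / (12 * real P))" for j
  proof -
    have A0: "?A j > 0" using pos by (simp add: cofactor_def prod_pos)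
    have "(\<Sum>m\<in>residue_box p. ?x m j * ?x m j) = ?A j * (\<Sum>y<p j. (real y / real (p j) - 1/2)\<^sup>2)"
      using sum_box_coordinate[where g = "\<lambda>y. (real y / real (p j) - 1/2)\<^sup>2" and p = p and j = j]
      by (simp add: power2_eq_square)
    also have "\<dots> = ?A j * (real (p j) / 12 + 1 / (6 * real (p j)))"
      using pos by (simp add: sum_centered_square)
    finally show ?thesis using p0[of j] A0 unfolding PA[of j]
      by (simp add: field_simps power2_eq_square)
  qed
  have off: "(\<Sum>m\<in>residue_box p. ?x m j * ?x m k) = ?A j * ?A k / (4 * real P)" if "j \<noteq> k" for j k
  proof -
    define R where "R = (\<Prod>i\<in>UNIV - {j} - {k}. real (p i))"
    have "UNIV - {k} - {j} = UNIV - {j} - {k}" by auto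
    then have A: "?A j = real (p k) * R" "?A k = real (p j) * R"
      unfolding cofactor_def of_nat_prod R_def using that
      by (simp_all add: prod.remove[of "UNIV - {j}" k] prod.remove[of "UNIV - {k}" j])
    have "(\<Sum>m\<in>residue_box p. ?x m j * ?x m k) = R / 4"
      using sum_box_two_coordinates[OF that, where p = p and
          g = "\<lambda>y. real y / real (p j) - 1/2" and h = "\<lambda>y. real y / real (p k) - 1/2"]
      unfolding sum_centered[OF pos] R_def by simp
    moreover have "R > 0" unfolding R_def using pos by (simp add: prod_pos)
    ultimately show ?thesis
      using p0[of j] p0[of k] unfolding PA[of j] A by (simp add: field_simps)
  qed
  have "(\<Sum>m\<in>residue_box p. (\<Sum>j\<in>UNIV. ?x m j)\<^sup>2)
      = (\<Sum>m\<in>residue_box p. \<Sum>j\<in>UNIV. \<Sum>k\<in>UNIV. ?x m j * ?x m k)"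
    by (simp only: power2_eq_square sum_product)
  also have "\<dots> = (\<Sum>j\<in>UNIV. \<Sum>m\<in>residue_box p. \<Sum>k\<in>UNIV. ?x m j * ?x m k)"
    by (rule sum.swap)
  also have "\<dots> = (\<Sum>j\<in>UNIV. \<Sum>k\<in>UNIV. \<Sum>m\<in>residue_box p. ?x m j * ?x m k)"
    by (intro sum.cong refl sum.swap)
  also have "\<dots> = (\<Sum>j\<in>UNIV. \<Sum>k\<in>UNIV. ?A j * ?A k / (4 * real P)
      + (if k = j then real P / 12 - (?A j)\<^sup>2 / (12 * real P) else 0))"
    using diag off by (intro sum.cong refl) auto
  also have "\<dots> = (\<Sum>j\<in>UNIV. \<Sum>k\<in>UNIV. ?A j * ?A k) / (4 * real P)
      + (real CARD('n) * real P / 12 - (\<Sum>j\<in>UNIV. (?A j)\<^sup>2) / (12 * real P))"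
    by (simp add: sum.distrib sum_subtractf sum_divide_distrib)
  also have "\<dots> = (\<Sum>j\<in>UNIV. ?A j)\<^sup>2 / (4 * real P)
      + (real CARD('n) * real P / 12 - (\<Sum>j\<in>UNIV. (?A j)\<^sup>2) / (12 * real P))"
    by (simp only: power2_eq_square sum_product)
  also have "\<dots> = real CARD('n) * real P / 12 + (\<Sum>j\<in>UNIV. (?A j)\<^sup>2) / (6 * real P)
      + ((\<Sum>j\<in>UNIV. ?A j)\<^sup>2 - (\<Sum>j\<in>UNIV. (?A j)\<^sup>2)) / (4 * real P)"
    using P0 by (simp add: field_simps)
  finally show ?thesis .
qed

section \<open>The coefficient and the Casson invariant\<close>

text \<open>The square of the centred level splits into the moment of the coordinates, the mixed moments, which
  carry the Dedekind sums, and the moment of the Bernoulli function. The multiples of \<open>M P\<close> and \<open>P\<close> in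
  these moments cancel against the constant \<open>- (M + 1) / 24\<close> summed over the \<open>P\<close> points of the
  box.\<close>

theorem beck_chen:
  fixes p :: "'n::finite \<Rightarrow> nat"
  assumes M: "CARD('n) \<ge> 2"
    and pos: "\<And>j. p j > 0" and cop: "\<And>i k. i \<noteq> k \<Longrightarrow> coprime (p i) (p k)"
  defines "P \<equiv> \<Prod>j\<in>UNIV. p j"
  shows "fact (CARD('n) - 2) * coeff (ehrhart_poly (tetrahedron p)) (CARD('n) - 2)
       = real CARD('n) / 4
         + 1 / (24 * real P) * (2 - (\<Sum>k\<in>UNIV. (real P / real (p k))\<^sup>2)
             + 3 * (\<Sum>k\<in>UNIV. real P / real (p k))\<^sup>2)
         - (\<Sum>k\<in>UNIV. dedekind_sum (P div p k) (p k))"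
proof -
  let ?M = "real CARD('n)"
  let ?X = "\<lambda>m. \<Sum>j\<in>UNIV. real (m j) / real (p j) - 1/2"
  let ?B = "\<lambda>m. bern P (weight p m)"
  let ?D = "\<Sum>k\<in>UNIV. dedekind_sum (cofactor p k) (p k)"
  define S where "S = (\<Sum>k\<in>UNIV. real (cofactor p k))"
  define S2 where "S2 = (\<Sum>k\<in>UNIV. (real (cofactor p k))\<^sup>2)"
  have P0: "real P > 0" using pos by (simp add: P_def prod_pos)
  have Pdiv: "P div p k = cofactor p k" "real P / real (p k) = real (cofactor p k)" for k
    unfolding P_def prod_eq_mult_cofactor[of p k] using pos[of k] by simp_all
  have XB: "(\<Sum>m\<in>residue_box p. ?X m * ?B m) = ?M / 4 - ?D"
  proof -
    have "(\<Sum>m\<in>residue_box p. ?X m * ?B m)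
        = (\<Sum>j\<in>UNIV. \<Sum>m\<in>residue_box p. (real (m j) / real (p j) - 1/2) * ?B m)"
      unfolding sum_distrib_right by (rule sum.swap)
    also have "\<dots> = (\<Sum>j\<in>UNIV. 1/4 - dedekind_sum (cofactor p j) (p j))"
    proof (rule sum.cong[OF refl])
      fix j :: 'n
      have "(\<Sum>m\<in>residue_box p. (real (m j) / real (p j) - 1/2) * ?B m)
          = (\<Sum>y<p j. (real y / real (p j) - 1/2) * bern (p j) (y * cofactor p j))"
        using bern_cross_moment[of p "\<lambda>y. real y / real (p j) - 1/2" j] pos cop
        by (simp add: P_def)
      also have "\<dots> = 1/4 - dedekind_sum (cofactor p j) (p j)"
        using pos[of j] coprime_cofactor[of p j] cop by (intro sum_centered_bern) auto
      finally show "(\<Sum>m\<in>residue_box p. (real (m j) / real (p j) - 1/2) * ?B m)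
          = 1/4 - dedekind_sum (cofactor p j) (p j)" .
    qed
    finally show ?thesis by (simp add: sum_subtractf)
  qed
  have "fact (CARD('n) - 2) * coeff (ehrhart_poly (tetrahedron p)) (CARD('n) - 2)
      = (\<Sum>m\<in>residue_box p. (of_int (level p m) - (?M + 1) / 2)\<^sup>2 / 2 - (?M + 1) / 24)"
    unfolding ehrhart_poly_tetrahedron[of p, OF pos] coeff_sum sum_distrib_left
    by (intro sum.cong refl coeff_shifted_binomial M)
  also have "\<dots> = (\<Sum>m\<in>residue_box p. (?X m + ?B m)\<^sup>2 / 2 - (?M + 1) / 24)"
    using centered_level[of p] pos by (simp add: P_def)
  also have "\<dots> = (\<Sum>m\<in>residue_box p. (?X m)\<^sup>2 / 2 + ?X m * ?B m + (?B m)\<^sup>2 / 2 - (?M + 1) / 24)"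
    by (intro sum.cong refl) (simp add: power2_eq_square algebra_simps)
  also have "\<dots> = (\<Sum>m\<in>residue_box p. (?X m)\<^sup>2) / 2 + (\<Sum>m\<in>residue_box p. ?X m * ?B m)
      + (\<Sum>m\<in>residue_box p. (?B m)\<^sup>2) / 2 - real P * (?M + 1) / 24"
    by (simp only: sum.distrib sum_subtractf sum_divide_distrib sum_constant card_residue_box P_def)
  also have "\<dots> = (?M * real P / 12 + S2 / (6 * real P) + (S\<^sup>2 - S2) / (4 * real P)) / 2
      + (?M / 4 - ?D) + (real P / 12 + 1 / (6 * real P)) / 2 - real P * (?M + 1) / 24"
    using centered_coordinates_second_moment[of p] bern_second_moment[of p] pos cop
    unfolding XB by (simp add: P_def S_def S2_def del: of_nat_prod)
  also have "\<dots> = ?M / 4 + 1 / (24 * real P) * (2 - S2 + 3 * S\<^sup>2) - ?D"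
    using P0 by (simp add: field_simps)
  finally show ?thesis by (simp add: Pdiv S_def S2_def)
qed

lemma square_sum_linorder:
  fixes x :: "'n::{finite,linorder} \<Rightarrow> real"
  shows "(\<Sum>k\<in>UNIV. x k)\<^sup>2 = (\<Sum>k\<in>UNIV. (x k)\<^sup>2) + 2 * (\<Sum>(j,k)\<in>{(j,k). j < k}. x j * x k)"
proof -
  let ?f = "\<lambda>(j,k). x j * x k"
  have U: "(UNIV :: ('n \<times> 'n) set) = range (\<lambda>k. (k,k)) \<union> ({(j,k). j < k} \<union> {(j,k). k < j})"
    by (auto simp: neq_iff)
  have "(\<Sum>k\<in>UNIV. x k)\<^sup>2 = sum ?f UNIV"
    by (simp add: power2_eq_square sum_product sum.cartesian_product)
  also have "\<dots> = sum ?f (range (\<lambda>k. (k,k))) + (sum ?f {(j,k). j < k} + sum ?f {(j,k). k < j})"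
    unfolding U by (subst sum.union_disjoint, simp, simp, force, subst sum.union_disjoint) auto
  also have "sum ?f (range (\<lambda>k. (k,k))) = (\<Sum>k\<in>UNIV. (x k)\<^sup>2)"
    by (subst sum.reindex) (auto simp: inj_on_def power2_eq_square)
  also have "sum ?f {(j,k). k < j} = sum ?f {(j,k). j < k}"
    by (rule sum.reindex_bij_witness[of _ prod.swap prod.swap]) (auto simp: mult.commute)
  finally show ?thesis by simp
qed

theorem proposition21:
  fixes p :: "'n::{finite,linorder} \<Rightarrow> nat" and M P :: nat
  assumes "CARD('n) = M" and "M \<ge> 3"
    and "\<And>j. p j \<ge> 2"
    and "\<And>j k. j \<noteq> k \<Longrightarrow> coprime (p j) (p k)"
    and "P = (\<Prod>j\<in>UNIV. p j)"
  shows "casson_seifert p - fact (M - 2) / 2 * coeff (ehrhart_poly (tetrahedron p)) (M - 2)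
       = - (real M + 1) / 8 - (real M - 2) / 24 * real P
         - real P / 8 * (\<Sum>(j,k)\<in>{(j,k). j < k}. 1 / (real (p j) * real (p k)))"
proof -
  have pos: "p j > 0" for j using assms(3)[of j] by simp
  then have P0: "real P > 0" using assms(5) by (simp add: prod_pos)
  define S where "S = (\<Sum>k\<in>UNIV. real P / real (p k))"
  define S2 where "S2 = (\<Sum>k\<in>UNIV. (real P / real (p k))\<^sup>2)"
  define D where "D = (\<Sum>k\<in>UNIV. dedekind_sum (P div p k) (p k))"
  define T where "T = (\<Sum>(j,k)\<in>{(j,k). j < k}. 1 / (real (p j) * real (p k)))"
  have "S\<^sup>2 = S2 + 2 * (\<Sum>(j,k)\<in>{(j,k). j < k}. real P / real (p j) * (real P / real (p k)))"
    unfolding S_def S2_def by (rule square_sum_linorder)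
  also have "(\<Sum>(j,k)\<in>{(j,k). j < k}. real P / real (p j) * (real P / real (p k))) = (real P)\<^sup>2 * T"
    unfolding T_def sum_distrib_left by (intro sum.cong) (auto simp: power2_eq_square)
  finally have T: "S\<^sup>2 = S2 + 2 * ((real P)\<^sup>2 * T)" .
  have "fact (M - 2) * coeff (ehrhart_poly (tetrahedron p)) (M - 2)
      = real M / 4 + 1 / (24 * real P) * (2 - S2 + 3 * S\<^sup>2) - D"
    using beck_chen[of p] assms pos by (simp add: S_def S2_def D_def)
  then have co: "fact (M - 2) / 2 * coeff (ehrhart_poly (tetrahedron p)) (M - 2)
      = (real M / 4 + 1 / (24 * real P) * (2 - S2 + 3 * S\<^sup>2) - D) / 2"
    by simp
  have ca: "casson_seifert p
      = - 1/8 + 1 / (24 * real P) * (1 + S2 - (real M - 2) * (real P)\<^sup>2) - 1/2 * D"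
    using assms by (simp add: casson_seifert_def Let_def S2_def D_def)
  show ?thesis
    unfolding co ca T T_def[symmetric] using P0
    by (simp add: field_simps power2_eq_square)
qed

end
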